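(* Let $G$ be a connected graph with $\kappa(G)=1$ and let $B_1,\ldots,B_r$ be the blocks of $G$. Then $mvd(G)=\left(\sum_{i=1}^{r} mvd(B_i)\right)-r+1$.
   Context: All graphs are finite, simple, undirected and connected. A block of $G$ is a maximal connected subgraph of $G$ that has no cut-vertex. For a vertex-colored graph and two nonadjacent vertices $x,y$, an $x$-$y$ vertex cut is a set $S\subseteq V(G)\setminus\{x,y\}$ such that $x$ and $y$ lie in different components of $G-S$; it is monochromatic if all its vertices have the same color. A vertex-coloring is an MVD-coloring if every pair of nonadjacent vertices has a monochromatic vertex cut separating them. $mvd(G)$ is the maximum number of colors used by an MVD-coloring of $G$ (so $mvd(K_m)=m$). *)

theory Defs
  imports "Graph_Theory.Digraph_Component"
begin

text \<open>
  A finite simple undirected graph is a \<open>graph\<close> in the sense of the library: a finite, symmetric,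
  loop-free digraph without parallel arcs, each edge being represented by its two arcs. In such
  a graph the strongly connected components \<open>sccs_verts\<close> are the vertex sets of the connected
  components. The library's \<open>connected\<close> excludes the graph without vertices.
\<close>

definition delete_verts :: "('a,'b) pre_digraph \<Rightarrow> 'a set \<Rightarrow> ('a,'b) pre_digraph" where
  "delete_verts G S = G \<restriction> (verts G - S)"

text \<open>The clause on the number of remaining vertices gives the usual value \<open>n - 1\<close> for the complete
  graph on \<open>n\<close> vertices.\<close>

definition vertex_connectivity :: "('a,'b) pre_digraph \<Rightarrow> nat" where
  "vertex_connectivity G =
     (LEAST k. \<exists>S \<subseteq> verts G. card S = k \<and>
        (\<not> Digraph_Component.connected (delete_verts G S) \<or> card (verts G - S) \<le> 1))"

definition cut_vertex :: "('a,'b) pre_digraph \<Rightarrow> 'a \<Rightarrow> bool" where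
  "cut_vertex G v \<longleftrightarrow> v \<in> verts G \<and>
     card (pre_digraph.sccs_verts (delete_verts G {v})) > card (pre_digraph.sccs_verts G)"

text \<open>The conjunct \<open>graph H\<close> is needed because a \<open>subgraph\<close> of a symmetric digraph may fail to be
  symmetric.\<close>

definition blocks :: "('a,'b) pre_digraph \<Rightarrow> ('a,'b) pre_digraph set" where
  "blocks G = {B. pre_digraph.max_subgraph G
     (\<lambda>H. graph H \<and> Digraph_Component.connected H \<and> (\<nexists>v. cut_vertex H v)) B}"

definition vertex_cut :: "('a,'b) pre_digraph \<Rightarrow> 'a \<Rightarrow> 'a \<Rightarrow> 'a set \<Rightarrow> bool" where
  "vertex_cut G x y S \<longleftrightarrow> S \<subseteq> verts G - {x, y} \<and>
     (\<exists>C \<in> pre_digraph.sccs_verts (delete_verts G S).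
      \<exists>D \<in> pre_digraph.sccs_verts (delete_verts G S). C \<noteq> D \<and> x \<in> C \<and> y \<in> D)"

definition monochromatic :: "('a \<Rightarrow> 'c) \<Rightarrow> 'a set \<Rightarrow> bool" where
  "monochromatic c S \<longleftrightarrow> (\<forall>u \<in> S. \<forall>v \<in> S. c u = c v)"

definition mvd_coloring :: "('a,'b) pre_digraph \<Rightarrow> ('a \<Rightarrow> 'c) \<Rightarrow> bool" where
  "mvd_coloring G c \<longleftrightarrow>
     (\<forall>x \<in> verts G. \<forall>y \<in> verts G. x \<noteq> y \<and> (x, y) \<notin> arcs_ends G \<longrightarrow>
        (\<exists>S. vertex_cut G x y S \<and> monochromatic c S))"

definition mvd :: "('a,'b) pre_digraph \<Rightarrow> nat" where
  "mvd G = Max {card (c ` verts G) | c :: 'a \<Rightarrow> nat. mvd_coloring G c}"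

end

theory Submission
  imports Defs
begin

text \<open>
  If \<open>v\<close> is a cut vertex of a connected graph \<open>G\<close>, then \<open>G\<close> is the union of two smaller connected
  induced subgraphs \<open>G\<^sub>1\<close> and \<open>G\<^sub>2\<close> that share exactly the vertex \<open>v\<close>. A connected subgraph without
  cut vertex lies in one of the two sides, so the blocks of \<open>G\<close> are those of \<open>G\<^sub>1\<close> together with
  those of \<open>G\<^sub>2\<close>. A coloring of \<open>G\<close> is an MVD-coloring iff both restrictions are: vertices on
  different sides are separated by \<open>{v}\<close>, and cuts of \<open>G\<^sub>i\<close> remain cuts in \<open>G\<close>. After renaming colors
  the two sides share only the color of \<open>v\<close>, whence \<open>mvd G + 1 = mvd G\<^sub>1 + mvd G\<^sub>2\<close>. The formula
  follows by induction on the number of vertices; a graph without cut vertex is its only block.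
\<close>

subsection \<open>Connectivity via sets closed under adjacency\<close>

text \<open>The set of vertices reachable from \<open>u\<close> is itself closed under adjacency, so
  it is the least closed set containing \<open>u\<close>. Connectivity and separation can thus be
  argued by exhibiting closed sets instead of handling walks.\<close>

lemma (in sym_digraph) reachable_iff_closed:
  "u \<rightarrow>\<^sup>* w \<longleftrightarrow> u \<in> verts G \<and> w \<in> verts G \<and> (\<forall>A. arcs_ends G `` A \<subseteq> A \<longrightarrow> u \<in> A \<longrightarrow> w \<in> A)"
  (is "?L \<longleftrightarrow> ?R")
proof
  assume ?L
  then have "w \<in> A" if "arcs_ends G `` A \<subseteq> A" "u \<in> A" for A
    using that by (induction rule: reachable_induct) auto
  then show ?R using \<open>?L\<close> by (auto dest: reachable_in_verts)
next
  assume R: ?R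
  have "arcs_ends G `` {z. u \<rightarrow>\<^sup>* z} \<subseteq> {z. u \<rightarrow>\<^sup>* z}"
    by (auto intro: reachable_adj_trans)
  with R show ?L by auto
qed

lemma connected_iff_strongly_connected:
  assumes "graph G"
  shows "Digraph_Component.connected G \<longleftrightarrow> strongly_connected G"
proof -
  interpret graph G by fact
  show ?thesis
    unfolding Digraph_Component.connected_def strongly_connected_def
    by (simp add: reachable_mk_symmetric_eq[OF sym_arcs])
qed

lemma connected_iff_closed:
  assumes "graph G"
  shows "Digraph_Component.connected G \<longleftrightarrow> verts G \<noteq> {} \<and>
    (\<forall>A. arcs_ends G `` A \<subseteq> A \<longrightarrow> A \<inter> verts G \<noteq> {} \<longrightarrow> verts G \<subseteq> A)"
proof -
  interpret graph G by fact
  show ?thesis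
    unfolding connected_iff_strongly_connected[OF assms] strongly_connected_def reachable_iff_closed
    by blast
qed

lemma graph_induce_subgraph:
  assumes "graph G" "S \<subseteq> verts G"
  shows "graph (G \<restriction> S)"
proof -
  interpret graph G by fact
  have "induced_subgraph (G \<restriction> S) G" using assms(2) by (rule induced_induce)
  then show ?thesis
    by (metis digraphI_induced digraph.graphI induced_graph_imp_symmetric sym_arcs)
qed

lemma arcs_ends_induce_subgraph:
  "arcs_ends (G \<restriction> S) = arcs_ends G \<inter> S \<times> S"
  by (auto simp: arcs_ends_conv)

text \<open>\<open>A\<close> witnesses the cut: it is a union of components of the graph without
  \<open>S\<close>, with \<open>x\<close> inside and \<open>y\<close> outside. Only its part outside
  \<open>S\<close> matters, so \<open>A\<close> is left otherwise unconstrained, which makes it easy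
  to restrict or enlarge when passing between graphs.\<close>

lemma vertex_cut_iff_closed:
  assumes "graph G" "x \<in> verts G" "y \<in> verts G"
  shows "vertex_cut G x y S \<longleftrightarrow> S \<subseteq> verts G - {x, y} \<and>
    (\<exists>A. x \<in> A \<and> y \<notin> A \<and> (\<forall>(a, b) \<in> arcs_ends G. a \<notin> S \<longrightarrow> b \<notin> S \<longrightarrow> a \<in> A \<longrightarrow> b \<in> A))"
proof (cases "S \<subseteq> verts G - {x, y}")
  case True
  interpret G: graph G by fact
  interpret H: graph "delete_verts G S"
    unfolding delete_verts_def using assms(1) by (rule graph_induce_subgraph) auto
  have xy: "x \<in> verts (delete_verts G S)" "y \<in> verts (delete_verts G S)"
    using True assms by (auto simp: delete_verts_def)
  have "vertex_cut G x y S \<longleftrightarrow> \<not> x \<rightarrow>\<^sup>*\<^bsub>delete_verts G S\<^esub> y"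
  proof
    assume "vertex_cut G x y S"
    then show "\<not> x \<rightarrow>\<^sup>*\<^bsub>delete_verts G S\<^esub> y"
      unfolding vertex_cut_def
      by (metis H.sccs_verts_disjoint H.in_sccs_verts_conv_reachable H.symmetric_reachable' disjoint_iff)
  next
    assume *: "\<not> x \<rightarrow>\<^sup>*\<^bsub>delete_verts G S\<^esub> y"
    have "H.scc_of x \<noteq> H.scc_of y"
      using * H.in_scc_of_self[OF xy(2)] by (auto simp: H.scc_of_def)
    then show "vertex_cut G x y S"
      unfolding vertex_cut_def
      using True H.scc_of_in_sccs_verts xy H.in_scc_of_self by metis
  qed
  also have "\<dots> \<longleftrightarrow> (\<exists>A. arcs_ends (delete_verts G S) `` A \<subseteq> A \<and> x \<in> A \<and> y \<notin> A)"
    using xy by (auto simp: H.reachable_iff_closed)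
  also have "arcs_ends (delete_verts G S) = {(a, b) \<in> arcs_ends G. a \<notin> S \<and> b \<notin> S}"
    unfolding delete_verts_def arcs_ends_induce_subgraph
    by (auto dest: G.adj_in_verts)
  finally show ?thesis using True by fast
qed (auto simp: vertex_cut_def)

text \<open>A connected graph has exactly one component, so the component count grows iff deleting
  \<open>v\<close> leaves two distinct components; a representative of each gives \<open>x\<close>
  and \<open>y\<close>.\<close>

lemma cut_vertex_iff_vertex_cut:
  assumes "graph G" "Digraph_Component.connected G"
  shows "cut_vertex G v \<longleftrightarrow> v \<in> verts G \<and> (\<exists>x \<in> verts G. \<exists>y \<in> verts G. vertex_cut G x y {v})"
proof -
  interpret G: graph G by fact
  interpret H: graph "delete_verts G {v}"
    unfolding delete_verts_def using assms(1) by (rule graph_induce_subgraph) auto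
  have "strongly_connected G" using assms by (simp add: connected_iff_strongly_connected)
  then have "G.sccs_verts = {verts G}"
    unfolding G.sccs_verts_conv_scc_of by (auto simp: G.scc_of_def strongly_connected_def dest: G.reachable_in_verts)
  then have *: "cut_vertex G v \<longleftrightarrow> v \<in> verts G \<and> card H.sccs_verts > 1"
    by (simp add: cut_vertex_def)
  also have "card H.sccs_verts > 1 \<longleftrightarrow> (\<exists>C \<in> H.sccs_verts. \<exists>D \<in> H.sccs_verts. C \<noteq> D)"
    using H.finite_sccs_verts by (metis One_nat_def card_le_Suc0_iff_eq not_le)
  also have "v \<in> verts G \<and> \<dots> \<longleftrightarrow> v \<in> verts G \<and> (\<exists>x \<in> verts G. \<exists>y \<in> verts G. vertex_cut G x y {v})"
  proof (intro conj_cong refl iffI)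
    assume "v \<in> verts G" "\<exists>C \<in> H.sccs_verts. \<exists>D \<in> H.sccs_verts. C \<noteq> D"
    then obtain C D where CD: "C \<in> H.sccs_verts" "D \<in> H.sccs_verts" "C \<noteq> D" by blast
    then obtain x y where xy: "x \<in> C" "y \<in> D"
      by (auto simp: H.in_sccs_verts_conv_reachable)
    then have "x \<in> verts G - {v}" "y \<in> verts G - {v}"
      using CD H.sccs_verts_subsets by (auto simp: delete_verts_def)
    then show "\<exists>x \<in> verts G. \<exists>y \<in> verts G. vertex_cut G x y {v}"
      using CD xy \<open>v \<in> verts G\<close> unfolding vertex_cut_def by blast
  qed (auto simp: vertex_cut_def)
  finally show ?thesis .
qed

subsection \<open>MVD-colorings\<close>

text \<open>Deleting all vertices other than \<open>x\<close> and \<open>y\<close> isolates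
  \<open>x\<close>. The lemma ensures that the maximum defining \<open>mvd\<close> ranges over a
  nonempty set.\<close>

lemma mvd_coloring_const:
  assumes "graph G"
  shows "mvd_coloring G (\<lambda>_. k)"
  unfolding mvd_coloring_def
proof (intro ballI impI)
  fix x y assume xy: "x \<in> verts G" "y \<in> verts G" "x \<noteq> y \<and> (x, y) \<notin> arcs_ends G"
  interpret graph G by fact
  have "vertex_cut G x y (verts G - {x, y})"
    unfolding vertex_cut_iff_closed[OF assms xy(1,2)] using xy
    by (auto intro!: exI[of _ "{x}"] dest: adj_in_verts)
  then show "\<exists>S. vertex_cut G x y S \<and> monochromatic (\<lambda>_. k) S"
    by (auto simp: monochromatic_def)
qed

lemma finite_mvd_set:
  assumes "graph G"
  shows "finite {card (c ` verts G) | c :: 'a \<Rightarrow> nat. mvd_coloring G c}"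
proof -
  interpret graph G by fact
  show ?thesis
    by (rule finite_subset[of _ "{..card (verts G)}"]) (auto intro: card_image_le)
qed

lemma card_le_mvd:
  fixes c :: "'a \<Rightarrow> nat"
  assumes "graph G" "mvd_coloring G c"
  shows "card (c ` verts G) \<le> mvd G"
  unfolding mvd_def using assms by (intro Max_ge finite_mvd_set) auto

lemma mvd_attained:
  assumes "graph G"
  obtains c :: "'a \<Rightarrow> nat" where "mvd_coloring G c" "card (c ` verts G) = mvd G"
proof -
  have "mvd G \<in> {card (c ` verts G) | c :: 'a \<Rightarrow> nat. mvd_coloring G c}"
    unfolding mvd_def using mvd_coloring_const[OF assms, of 0]
    by (intro Max_in finite_mvd_set assms) auto
  then show ?thesis using that by auto
qed

text \<open>Merging colors keeps monochromatic sets monochromatic, and vertex cuts do not depend on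
  the coloring. Applied with an injective renaming of colors.\<close>

lemma mvd_coloring_coarsen:
  assumes "mvd_coloring G c" and "\<And>u w. c u = c w \<Longrightarrow> d u = d w"
  shows "mvd_coloring G d"
  using assms unfolding mvd_coloring_def monochromatic_def by meson

lemma mvd_coloring_cong:
  assumes "mvd_coloring G c" and "\<And>u. u \<in> verts G \<Longrightarrow> c u = d u"
  shows "mvd_coloring G d"
proof -
  have "monochromatic d S" if "vertex_cut G x y S" "monochromatic c S" for x y S
    using that assms(2) unfolding vertex_cut_def monochromatic_def by (metis Diff_subset subsetD)
  then show ?thesis using assms(1) unfolding mvd_coloring_def by meson
qed

subsection \<open>Splitting a graph at a cut vertex\<close>

text \<open>The conditions are symmetric in the two sides, so results are proved for
  \<open>V1\<close> and transferred by \<open>swap\<close>. The condition \<open>nontrivial\<close>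
  makes each side properly smaller than \<open>G\<close>, as the induction requires, and gives
  \<open>v\<close> a neighbor on each side.\<close>

locale split_graph = graph G for G :: "('a,'b) pre_digraph" +
  fixes V1 V2 v
  assumes connected: "Digraph_Component.connected G"
    and union: "V1 \<union> V2 = verts G"
    and inter: "V1 \<inter> V2 = {v}"
    and nontrivial: "V1 \<noteq> {v}" "V2 \<noteq> {v}"
    and arcs_split: "arcs_ends G \<subseteq> V1 \<times> V1 \<union> V2 \<times> V2"
begin

lemma swap: "split_graph G V2 V1 v"
  using connected union inter nontrivial arcs_split
  by unfold_locales auto

lemma graph_left: "graph (G \<restriction> V1)"
  using graph_axioms union by (intro graph_induce_subgraph) auto

lemma connected_left: "Digraph_Component.connected (G \<restriction> V1)"
proof -
  have "V1 \<subseteq> A" if cl: "arcs_ends (G \<restriction> V1) `` A \<subseteq> A" and ne: "A \<inter> V1 \<noteq> {}" for A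
  proof -
    \<comment> \<open>Arcs lead from \<open>V1\<close> into the rest of \<open>V2\<close> only
      through \<open>v\<close>, so adding all of \<open>V2\<close> exactly when \<open>v\<close>
      lies in \<open>A\<close> extends \<open>A\<close> to a set closed in \<open>G\<close>.\<close>
    define A' where "A' = A \<inter> V1 \<union> (if v \<in> A then V2 else {})"
    have "arcs_ends G `` A' \<subseteq> A'"
    proof (clarify)
      fix a b assume ab: "(a, b) \<in> arcs_ends G" "a \<in> A'"
      consider "a \<in> V1" "b \<in> V1" | "a \<in> V2" "b \<in> V2" using ab arcs_split by blast
      then show "b \<in> A'"
      proof cases
        case 1
        then have "a \<in> A" using ab inter by (auto simp: A'_def split: if_splits)
        then have "b \<in> A" using cl ab 1 by (auto simp: arcs_ends_induce_subgraph)
        then show ?thesis using 1 by (auto simp: A'_def)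
      next
        case 2
        then have "v \<in> A" using ab inter by (auto simp: A'_def split: if_splits)
        then show ?thesis using 2 by (auto simp: A'_def)
      qed
    qed
    moreover have "A' \<inter> verts G \<noteq> {}" using ne union by (auto simp: A'_def)
    ultimately have "verts G \<subseteq> A'"
      using connected unfolding connected_iff_closed[OF graph_axioms] by blast
    then have "V1 \<subseteq> A'" using union by auto
    then show ?thesis using inter by (auto simp: A'_def split: if_splits)
  qed
  moreover have "V1 \<noteq> {}" using inter by auto
  ultimately show ?thesis unfolding connected_iff_closed[OF graph_left] by simp
qed

lemma card_left_less: "card V1 < card (verts G)"
proof (rule psubset_card_mono)
  show "V1 \<subset> verts G" using union inter nontrivial by blast
qed simp

section \<open>MVD-colorings of the two sides\<close>

text \<open>Intersecting a cut of \<open>G\<close> with \<open>V1\<close> gives a cut of the left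
  side: the same closed set is a witness, since the induced subgraph only loses arcs.\<close>

lemma mvd_coloring_left:
  assumes "mvd_coloring G c"
  shows "mvd_coloring (G \<restriction> V1) c"
  unfolding mvd_coloring_def
proof (intro ballI impI)
  fix x y assume xy: "x \<in> verts (G \<restriction> V1)" "y \<in> verts (G \<restriction> V1)"
    "x \<noteq> y \<and> (x, y) \<notin> arcs_ends (G \<restriction> V1)"
  then have xyG: "x \<in> verts G" "y \<in> verts G" "x \<noteq> y" "(x, y) \<notin> arcs_ends G"
    using union by (auto simp: arcs_ends_induce_subgraph)
  then obtain S where S: "vertex_cut G x y S" "monochromatic c S"
    using assms unfolding mvd_coloring_def by blast
  have "vertex_cut (G \<restriction> V1) x y (S \<inter> V1)"
    using S(1) unfolding vertex_cut_iff_closed[OF graph_left xy(1,2)]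
      vertex_cut_iff_closed[OF graph_axioms xyG(1,2)] arcs_ends_induce_subgraph
    by fastforce
  moreover have "monochromatic c (S \<inter> V1)" using S(2) by (auto simp: monochromatic_def)
  ultimately show "\<exists>S. vertex_cut (G \<restriction> V1) x y S \<and> monochromatic c S" by blast
qed

text \<open>A path between vertices of \<open>V1\<close> that detours through the other side leaves
  and reenters at \<open>v\<close>, so the extra vertices create no new connection.\<close>

lemma vertex_cut_left:
  assumes xy: "x \<in> V1" "y \<in> V1" and cut: "vertex_cut (G \<restriction> V1) x y S"
  shows "vertex_cut G x y S"
proof -
  have xyG: "x \<in> verts G" "y \<in> verts G" using xy union by auto
  have xyV: "x \<in> verts (G \<restriction> V1)" "y \<in> verts (G \<restriction> V1)" using xy by auto
  obtain A where S: "S \<subseteq> V1 - {x, y}" and A: "x \<in> A" "y \<notin> A"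
    "\<And>a b. (a, b) \<in> arcs_ends G \<Longrightarrow> a \<in> V1 \<Longrightarrow> b \<in> V1 \<Longrightarrow> a \<notin> S \<Longrightarrow> b \<notin> S \<Longrightarrow> a \<in> A \<Longrightarrow> b \<in> A"
    using cut unfolding vertex_cut_iff_closed[OF graph_left xyV] arcs_ends_induce_subgraph by fastforce
  \<comment> \<open>If \<open>v\<close> is in the cut, nothing outside \<open>V1\<close> can be
    reached from \<open>x\<close>. Otherwise \<open>V2\<close> joins the side of \<open>x\<close>
    exactly when \<open>v\<close> is on that side.\<close>
  define A' where "A' = A \<inter> V1 \<union> (if v \<in> A \<and> v \<notin> S then V2 else {})"
  have "u = v" if "u \<in> V1" "u \<in> V2" for u using that inter by blast
  then have "x \<in> A'" "y \<notin> A'" using A xy by (auto simp: A'_def)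
  moreover have "b \<in> A'"
    if ab: "(a, b) \<in> arcs_ends G" "a \<notin> S" "b \<notin> S" "a \<in> A'" for a b
  proof -
    consider "a \<in> V1" "b \<in> V1" | "a \<in> V2" "b \<in> V2" using ab arcs_split by blast
    then show ?thesis
    proof cases
      case 1
      then have "a \<in> A" using ab inter by (auto simp: A'_def split: if_splits)
      then show ?thesis using A(3) ab 1 by (auto simp: A'_def)
    next
      case 2
      then have "v \<in> A \<and> v \<notin> S" using ab inter by (auto simp: A'_def split: if_splits)
      then show ?thesis using 2 by (auto simp: A'_def)
    qed
  qed
  ultimately show ?thesis
    unfolding vertex_cut_iff_closed[OF graph_axioms xyG] using S union by blast
qed

lemma vertex_cut_across:
  assumes "x \<in> V1 - {v}" "y \<in> V2 - {v}"
  shows "vertex_cut G x y {v}"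
proof -
  have xyG: "x \<in> verts G" "y \<in> verts G" using assms union by auto
  show ?thesis
    unfolding vertex_cut_iff_closed[OF graph_axioms xyG]
    using assms arcs_split inter union by (intro conjI exI[of _ V1]) auto
qed

lemma mvd_coloring_iff:
  "mvd_coloring G c \<longleftrightarrow> mvd_coloring (G \<restriction> V1) c \<and> mvd_coloring (G \<restriction> V2) c"
proof (intro iffI conjI)
  interpret sw: split_graph G V2 V1 v by (rule swap)
  { assume "mvd_coloring G c"
    then show "mvd_coloring (G \<restriction> V1) c" "mvd_coloring (G \<restriction> V2) c"
      by (rule mvd_coloring_left sw.mvd_coloring_left)+ }
  assume c: "mvd_coloring (G \<restriction> V1) c \<and> mvd_coloring (G \<restriction> V2) c"
  show "mvd_coloring G c"
    unfolding mvd_coloring_def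
  proof (intro ballI impI)
    fix x y assume xy: "x \<in> verts G" "y \<in> verts G" "x \<noteq> y \<and> (x, y) \<notin> arcs_ends G"
    then consider "x \<in> V1" "y \<in> V1" | "x \<in> V2" "y \<in> V2" | "x \<in> V1 - {v}" "y \<in> V2 - {v}"
      | "x \<in> V2 - {v}" "y \<in> V1 - {v}"
      using union inter by blast
    then show "\<exists>S. vertex_cut G x y S \<and> monochromatic c S"
    proof cases
      case 1
      then obtain S where "vertex_cut (G \<restriction> V1) x y S" "monochromatic c S"
        using c xy unfolding mvd_coloring_def arcs_ends_induce_subgraph by fastforce
      then show ?thesis using vertex_cut_left 1 by blast
    next
      case 2
      then obtain S where "vertex_cut (G \<restriction> V2) x y S" "monochromatic c S"
        using c xy unfolding mvd_coloring_def arcs_ends_induce_subgraph by fastforce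
      then show ?thesis using sw.vertex_cut_left 2 by blast
    next
      case 3
      then show ?thesis using vertex_cut_across[of x y] by (auto simp: monochromatic_def)
    next
      case 4
      then show ?thesis using sw.vertex_cut_across[of x y] by (auto simp: monochromatic_def)
    qed
  qed
qed

lemma mvd_split: "mvd G + 1 = mvd (G \<restriction> V1) + mvd (G \<restriction> V2)"
proof (rule antisym)
  interpret sw: split_graph G V2 V1 v by (rule swap)
  have fin: "finite V1" "finite V2" using union finite_verts by (metis finite_Un)+
  have v: "v \<in> V1" "v \<in> V2" using inter by auto
  show "mvd G + 1 \<le> mvd (G \<restriction> V1) + mvd (G \<restriction> V2)"
  proof -
    obtain c :: "'a \<Rightarrow> nat" where c: "mvd_coloring G c" "card (c ` verts G) = mvd G"
      using mvd_attained[OF graph_axioms] .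
    \<comment> \<open>The color of \<open>v\<close> occurs on both sides, so inclusion-exclusion on
      the color sets loses at least one color.\<close>
    have "c v \<in> c ` V1 \<inter> c ` V2" using v by auto
    then have "card (c ` V1 \<inter> c ` V2) \<ge> 1"
      using fin by (metis One_nat_def Suc_leI card_gt_0_iff empty_iff finite_Int finite_imageI)
    moreover have "card (c ` V1) + card (c ` V2) = card (c ` verts G) + card (c ` V1 \<inter> c ` V2)"
      using fin card_Un_Int[of "c ` V1" "c ` V2"] by (simp flip: union add: image_Un)
    moreover have "card (c ` V1) \<le> mvd (G \<restriction> V1)" "card (c ` V2) \<le> mvd (G \<restriction> V2)"
      using card_le_mvd[OF graph_left, of c] card_le_mvd[OF sw.graph_left, of c] c
      by (auto simp: mvd_coloring_iff)
    ultimately show ?thesis using c(2) by linarith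
  qed
  show "mvd (G \<restriction> V1) + mvd (G \<restriction> V2) \<le> mvd G + 1"
  proof -
    obtain c1 :: "'a \<Rightarrow> nat" where c1: "mvd_coloring (G \<restriction> V1) c1" "card (c1 ` V1) = mvd (G \<restriction> V1)"
      using mvd_attained[OF graph_left] by auto
    obtain c2 :: "'a \<Rightarrow> nat" where c2: "mvd_coloring (G \<restriction> V2) c2" "card (c2 ` V2) = mvd (G \<restriction> V2)"
      using mvd_attained[OF sw.graph_left] by auto
    \<comment> \<open>The renaming sends the color of \<open>v\<close> under \<open>c2\<close> to
      its color under \<open>c1\<close>, so the two colorings agree at \<open>v\<close>; every other
      color is moved above all colors of \<open>c1\<close>. Hence \<open>f\<close> is injective and
      \<open>c1 v\<close> is the only color that can be shared.\<close>
    define f where "f k = (if k = c2 v then c1 v else Suc (Max (c1 ` V1)) + k)" for k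
    define c where "c u = (if u \<in> V1 then c1 u else f (c2 u))" for u
    have le: "c1 u \<le> Max (c1 ` V1)" if "u \<in> V1" for u using that fin by auto
    have cV1: "c u = c1 u" if "u \<in> V1" for u using that by (simp add: c_def)
    have cV2: "c u = f (c2 u)" if "u \<in> V2" for u
      using that inter by (auto simp: c_def f_def)
    have "inj f"
      using le[OF v(1)] by (auto simp: inj_def f_def)
    have "c ` V2 = f ` c2 ` V2" using cV2 by (auto simp: image_iff)
    then have card2: "card (c ` V2) = card (c2 ` V2)"
      using card_image inj_on_subset[OF \<open>inj f\<close>] by (metis subset_UNIV)
    have card1: "c ` V1 = c1 ` V1" using cV1 by auto
    have "c ` V1 \<inter> c ` V2 \<subseteq> {c1 v}"
      using le cV1 cV2 by (fastforce simp: f_def split: if_splits)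
    then have "card (c ` V1 \<inter> c ` V2) \<le> 1"
      by (metis card.empty card_insert_disjoint card_mono empty_iff finite.emptyI finite_insert One_nat_def)
    moreover have "card (c ` V1) + card (c ` V2) = card (c ` verts G) + card (c ` V1 \<inter> c ` V2)"
      using fin card_Un_Int[of "c ` V1" "c ` V2"] by (simp flip: union add: image_Un)
    moreover have "mvd_coloring G c"
    proof -
      have "mvd_coloring (G \<restriction> V1) c"
        using c1(1) by (rule mvd_coloring_cong) (simp add: cV1)
      moreover have "mvd_coloring (G \<restriction> V2) (\<lambda>u. f (c2 u))"
        using c2(1) by (rule mvd_coloring_coarsen) simp
      then have "mvd_coloring (G \<restriction> V2) c"
        by (rule mvd_coloring_cong) (simp add: cV2)
      ultimately show ?thesis by (simp add: mvd_coloring_iff)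
    qed
    then have "card (c ` verts G) \<le> mvd G" by (rule card_le_mvd[OF graph_axioms])
    ultimately show ?thesis using card1 card2 c1(2) c2(2) by simp
  qed
qed

section \<open>Blocks of the two sides\<close>

text \<open>Suppose \<open>B\<close> has vertices other than \<open>v\<close> on both sides. If
  \<open>B\<close> misses \<open>v\<close>, then \<open>V1\<close> is closed in \<open>B\<close> and
  \<open>B\<close> is disconnected; if \<open>B\<close> contains \<open>v\<close>, then
  \<open>v\<close> is a cut vertex of \<open>B\<close>.\<close>

lemma subgraph_side:
  assumes "subgraph B G" "graph B" "Digraph_Component.connected B" "\<nexists>v. cut_vertex B v"
  shows "verts B \<subseteq> V1 \<or> verts B \<subseteq> V2"
proof (rule ccontr)
  assume "\<not> ?thesis"
  moreover have BG: "verts B \<subseteq> verts G" "arcs_ends B \<subseteq> arcs_ends G"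
    using assms(1) by (auto dest: subgraph_imp_subverts arcs_ends_mono)
  ultimately obtain x y where x: "x \<in> verts B" "x \<in> V1 - {v}" and y: "y \<in> verts B" "y \<in> V2 - {v}"
    using union inter by blast
  have "v \<in> verts B"
  proof (rule ccontr)
    assume "v \<notin> verts B"
    interpret B: graph B by fact
    have "b \<in> V1" if "(a, b) \<in> arcs_ends B" "a \<in> V1" for a b
    proof -
      have "a \<noteq> v" using that \<open>v \<notin> verts B\<close> by (auto dest: B.adj_in_verts)
      then show ?thesis using that BG(2) arcs_split inter by blast
    qed
    then have "arcs_ends B `` V1 \<subseteq> V1" by blast
    then have "verts B \<subseteq> V1"
      using assms(3) x unfolding connected_iff_closed[OF assms(2)] by blast
    then show False using y inter by auto
  qed
  moreover have "vertex_cut B x y {v}"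
    unfolding vertex_cut_iff_closed[OF assms(2) x(1) y(1)]
    using x y BG arcs_split inter \<open>v \<in> verts B\<close> by (intro conjI exI[of _ V1]) auto
  ultimately have "cut_vertex B v"
    using cut_vertex_iff_vertex_cut[OF assms(2,3)] x(1) y(1) by blast
  then show False using assms(4) by blast
qed

text \<open>A single vertex \<open>v\<close> is not a block of \<open>G \<restriction> V1\<close>, since \<open>v\<close> has a neighbor there and an edge is
  a connected graph without cut vertex.\<close>

lemma block_left_not_subset:
  assumes "B \<in> blocks (G \<restriction> V1)"
  shows "\<not> verts B \<subseteq> V2"
proof
  assume "verts B \<subseteq> V2"
  have B: "subgraph B (G \<restriction> V1)" "graph B" "Digraph_Component.connected B"
    and max: "\<And>H. H \<noteq> B \<Longrightarrow> subgraph B H \<Longrightarrow> subgraph H (G \<restriction> V1) \<Longrightarrow> graph H \<Longrightarrow>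
      Digraph_Component.connected H \<Longrightarrow> \<exists>u. cut_vertex H u"
    using assms unfolding blocks_def pre_digraph.max_subgraph_def by blast+
  interpret B: graph B by fact
  interpret L: graph "G \<restriction> V1" by (rule graph_left)
  have "verts B \<subseteq> V1" using subgraph_imp_subverts[OF B(1)] by simp
  moreover have "verts B \<noteq> {}" using B(3) by (simp add: connected_iff_closed[OF B(2)])
  ultimately have vB: "verts B = {v}" using \<open>verts B \<subseteq> V2\<close> inter by auto
  have "v \<in> V1" using inter by auto
  have "\<not> arcs_ends (G \<restriction> V1) `` {v} \<subseteq> {v}"
    using connected_left nontrivial \<open>v \<in> V1\<close> unfolding connected_iff_closed[OF graph_left] by auto
  then obtain w where w: "(v, w) \<in> arcs_ends (G \<restriction> V1)" "w \<noteq> v" by auto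
  then have "w \<in> V1" by (auto simp: arcs_ends_induce_subgraph)
  define H where "H = (G \<restriction> V1) \<restriction> {v, w}"
  have "graph H" unfolding H_def using \<open>v \<in> V1\<close> \<open>w \<in> V1\<close>
    by (intro graph_induce_subgraph graph_left) auto
  then interpret H: graph H .
  have ends: "(v, w) \<in> arcs_ends H" "(w, v) \<in> arcs_ends H"
    using w arcs_ends_symmetric[OF L.sym_arcs] by (auto simp: H_def arcs_ends_induce_subgraph[of "G \<restriction> V1"])
  have con: "Digraph_Component.connected H"
    unfolding connected_iff_closed[OF \<open>graph H\<close>] using ends by (auto simp: H_def)
  have sub: "subgraph H (G \<restriction> V1)"
    unfolding H_def using \<open>v \<in> V1\<close> \<open>w \<in> V1\<close> by (intro L.subgraph_induce_subgraphI) auto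
  \<comment> \<open>A loop-free graph on one vertex has no arcs, so \<open>B\<close> lies inside the
    edge \<open>H\<close>, a strictly larger competitor.\<close>
  have "arcs B = {}"
    using vB B.tail_in_verts B.head_in_verts B.no_loops by (metis singletonD equals0I)
  then have "subgraph B H"
    using B(1) sub vB by (auto simp: subgraph_def compatible_def H_def)
  moreover have "verts H = {v, w}" by (simp add: H_def)
  then have "H \<noteq> B" using vB w(2) by auto
  ultimately obtain u where "cut_vertex H u" using max[OF _ _ sub \<open>graph H\<close> con] by blast
  then obtain x y where "u \<in> verts H" "x \<in> verts H" "y \<in> verts H" "vertex_cut H x y {u}"
    using cut_vertex_iff_vertex_cut[OF \<open>graph H\<close> con] by blast
  \<comment> \<open>Deleting one end of an edge leaves a single vertex, so there are no two vertices
    to separate.\<close>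
  then show False using \<open>verts H = {v, w}\<close>
    by (auto simp: vertex_cut_iff_closed[OF \<open>graph H\<close>])
qed

text \<open>The point is to lift maximality from the left side to \<open>G\<close>. A competitor in
  \<open>G\<close> that contains \<open>B\<close> lies on one side by \<open>subgraph_side\<close>,
  and it cannot lie in \<open>V2\<close> because \<open>B\<close> does not; so it already competes
  within the left side.\<close>

lemma blocks_left_iff:
  "B \<in> blocks (G \<restriction> V1) \<longleftrightarrow> B \<in> blocks G \<and> verts B \<subseteq> V1"
proof -
  interpret L: graph "G \<restriction> V1" by (rule graph_left)
  have LG: "subgraph (G \<restriction> V1) G" using union by (intro subgraph_induce_subgraphI) auto
  have sub: "subgraph H (G \<restriction> V1) \<longleftrightarrow> subgraph H G \<and> verts H \<subseteq> V1" for H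
  proof
    assume "subgraph H (G \<restriction> V1)"
    then show "subgraph H G \<and> verts H \<subseteq> V1"
      using subgraph_trans[OF _ LG] subgraph_imp_subverts[of H "G \<restriction> V1"] by simp
  next
    assume "subgraph H G \<and> verts H \<subseteq> V1"
    then show "subgraph H (G \<restriction> V1)"
      by (auto simp: subgraph_def compatible_def L.wf_digraph wf_digraph_def subset_iff)
  qed
  show ?thesis
  proof
    assume B: "B \<in> blocks (G \<restriction> V1)"
    have "verts H \<subseteq> V1"
      if "subgraph B H" "subgraph H G" "graph H" "Digraph_Component.connected H" "\<nexists>v. cut_vertex H v" for H
      using subgraph_side[OF that(2-)] block_left_not_subset[OF B] subgraph_imp_subverts[OF that(1)]
      by blast
    then show "B \<in> blocks G \<and> verts B \<subseteq> V1"
      using B unfolding blocks_def pre_digraph.max_subgraph_def mem_Collect_eq sub by blast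
  next
    assume "B \<in> blocks G \<and> verts B \<subseteq> V1"
    then show "B \<in> blocks (G \<restriction> V1)"
      unfolding blocks_def pre_digraph.max_subgraph_def mem_Collect_eq sub by blast
  qed
qed

lemma blocks_split:
  "blocks G = blocks (G \<restriction> V1) \<union> blocks (G \<restriction> V2)"
  "blocks (G \<restriction> V1) \<inter> blocks (G \<restriction> V2) = {}"
proof -
  interpret sw: split_graph G V2 V1 v by (rule swap)
  have "verts B \<subseteq> V1 \<or> verts B \<subseteq> V2" if "B \<in> blocks G" for B
    using that subgraph_side unfolding blocks_def pre_digraph.max_subgraph_def by blast
  then show "blocks G = blocks (G \<restriction> V1) \<union> blocks (G \<restriction> V2)"
    using blocks_left_iff sw.blocks_left_iff by blast
  show "blocks (G \<restriction> V1) \<inter> blocks (G \<restriction> V2) = {}"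
    using block_left_not_subset sw.blocks_left_iff by blast
qed

end

section \<open>Existence of a split and the induction\<close>

lemma cut_vertex_split:
  assumes "graph G" "Digraph_Component.connected G" "cut_vertex G v"
  obtains V1 V2 where "split_graph G V1 V2 v"
proof -
  interpret graph G by fact
  obtain x y where v: "v \<in> verts G" and xy: "x \<in> verts G" "y \<in> verts G" and "vertex_cut G x y {v}"
    using assms(3) cut_vertex_iff_vertex_cut[OF assms(1,2)] by blast
  then obtain A where A: "x \<noteq> v" "y \<noteq> v" "x \<in> A" "y \<notin> A"
    "\<And>a b. (a, b) \<in> arcs_ends G \<Longrightarrow> a \<noteq> v \<Longrightarrow> b \<noteq> v \<Longrightarrow> a \<in> A \<Longrightarrow> b \<in> A"
    unfolding vertex_cut_iff_closed[OF assms(1) xy] by fastforce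
  \<comment> \<open>The closed set \<open>A\<close> and its complement become the two sides, each
    with \<open>v\<close> added.\<close>
  have "split_graph G (insert v (A \<inter> verts G)) (insert v (verts G - A)) v"
  proof unfold_locales
    show "arcs_ends G \<subseteq> insert v (A \<inter> verts G) \<times> insert v (A \<inter> verts G)
      \<union> insert v (verts G - A) \<times> insert v (verts G - A)"
      (is "_ \<subseteq> ?R")
    proof (rule subrelI)
      fix a b assume ab: "(a, b) \<in> arcs_ends G"
      then have "(b, a) \<in> arcs_ends G" "a \<in> verts G" "b \<in> verts G"
        using arcs_ends_symmetric[OF sym_arcs] adj_in_verts by auto
      then show "(a, b) \<in> ?R"
        \<comment> \<open>The reversed arc is needed to exclude arcs that enter \<open>A\<close>
          from outside while avoiding \<open>v\<close>.\<close>
        using ab A(5)[of a b] A(5)[of b a] by blast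
    qed
  qed (use assms v xy A(1-4) in auto)
  then show ?thesis using that by blast
qed

lemma blocks_no_cut_vertex:
  assumes "graph G" "Digraph_Component.connected G" "\<nexists>v. cut_vertex G v"
  shows "blocks G = {G}"
proof -
  interpret graph G by fact
  \<comment> \<open>Antisymmetry holds for the records themselves because \<open>compatible\<close>
    also identifies the tail and head functions.\<close>
  have "H = G" if "subgraph G H" "subgraph H G" for H
    using that by (auto simp: subgraph_def compatible_def)
  then show ?thesis
    unfolding blocks_def pre_digraph.max_subgraph_def using assms subgraph_refl
    by (intro set_eqI) (simp, metis)
qed

text \<open>Finiteness is carried through the induction because sums and cardinalities split over
  the disjoint union only for finite sets. Each side contributes a summand 1, and the 1 in
  \<open>mvd_split\<close> absorbs one of them. Without a cut vertex the right-hand side is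
  \<open>mvd G\<close> minus 1 plus 1.\<close>

lemma mvd_eq_sum_blocks:
  assumes "graph G" "Digraph_Component.connected G"
  shows "finite (blocks G) \<and>
    int (mvd G) = (\<Sum>B \<in> blocks G. int (mvd B)) - int (card (blocks G)) + 1"
  using assms
proof (induction "card (verts G)" arbitrary: G rule: less_induct)
  case less
  show ?case
  proof (cases "\<exists>v. cut_vertex G v")
    case False
    then show ?thesis using blocks_no_cut_vertex[OF less.prems] by simp
  next
    case True
    then obtain V1 V2 v where "split_graph G V1 V2 v"
      using cut_vertex_split[OF less.prems] by metis
    then interpret split_graph G V1 V2 v .
    interpret sw: split_graph G V2 V1 v by (rule swap)
    have 1: "finite (blocks (G \<restriction> V1))"
      "int (mvd (G \<restriction> V1)) = (\<Sum>B \<in> blocks (G \<restriction> V1). int (mvd B)) - int (card (blocks (G \<restriction> V1))) + 1"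
      using less.hyps[OF _ graph_left connected_left] card_left_less by simp_all
    have 2: "finite (blocks (G \<restriction> V2))"
      "int (mvd (G \<restriction> V2)) = (\<Sum>B \<in> blocks (G \<restriction> V2). int (mvd B)) - int (card (blocks (G \<restriction> V2))) + 1"
      using less.hyps[OF _ sw.graph_left sw.connected_left] sw.card_left_less by simp_all
    have "int (mvd G) + 1 = int (mvd (G \<restriction> V1)) + int (mvd (G \<restriction> V2))"
      using mvd_split by linarith
    then show ?thesis
      using 1 2 blocks_split by (simp add: sum.union_disjoint card_Un_disjoint)
  qed
qed

theorem theorem1p3:
  fixes G :: "('a,'b) pre_digraph"
  assumes "graph G"
    and "Digraph_Component.connected G"
    and "vertex_connectivity G = 1"
  shows "int (mvd G) = (\<Sum>B \<in> blocks G. int (mvd B)) - int (card (blocks G)) + 1"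
  using mvd_eq_sum_blocks[OF assms(1,2)] by blast

end
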